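(* Let $n\ge 2$. For every domain $D\subsetneq\mathbb{R}^n$ and all $x,y\in D$, $$(2\log 3)\,s_D(x,y)\le u_D(x,y)\le 3\log\frac{1+s_D(x,y)}{1-s_D(x,y)},$$ where the right-hand side is understood as $+\infty$ if $s_D(x,y)=1$. Both inequalities are sharp, i.e. the constant $2\log 3$ on the left cannot be replaced by any larger constant, and the constant $3$ on the right cannot be replaced by any smaller constant, so that the corresponding inequality holds for all domains $D\subsetneq\mathbb{R}^n$ and all $x,y\in D$.
   Context: A domain is a nonempty open connected set. For a domain $D\subsetneq\mathbb{R}^n$ and $x\in D$, $d(x)$ denotes the Euclidean distance from $x$ to $\partial D$. The Gromov hyperbolic metric $u_D$ is $$u_D(x,y)=2\log\frac{|x-y|+\max\{d(x),d(y)\}}{\sqrt{d(x)\,d(y)}},\qquad x,y\in D.$$ The triangular ratio metric is $$s_D(x,y)=\sup_{p\in\partial D}\frac{|x-y|}{|x-p|+|y-p|}\in[0,1],\qquad x,y\in D.$$ *)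

theory Defs
  imports "HOL-Analysis.Analysis"
begin

definition domain :: "'a::topological_space set \<Rightarrow> bool" where
  "domain D \<longleftrightarrow> D \<noteq> {} \<and> open D \<and> connected D"

text \<open>A domain other than the whole space has nonempty boundary (the whole space being
  connected), so the infimum and the supremum below range over nonempty sets.\<close>

definition bdist :: "'a::metric_space set \<Rightarrow> 'a \<Rightarrow> real" where
  "bdist D x = infdist x (frontier D)"

definition gromov_metric :: "'a::metric_space set \<Rightarrow> 'a \<Rightarrow> 'a \<Rightarrow> real" where
  "gromov_metric D x y =
     2 * ln ((dist x y + max (bdist D x) (bdist D y)) / sqrt (bdist D x * bdist D y))"

definition triangular_ratio :: "'a::metric_space set \<Rightarrow> 'a \<Rightarrow> 'a \<Rightarrow> real" where
  "triangular_ratio D x y = (SUP p\<in>frontier D. dist x y / (dist x p + dist y p))"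

text \<open>The value at \<open>1\<close> is set explicitly, since division by zero and \<open>ln 0\<close> would give \<open>0\<close>.\<close>

definition log_ratio :: "real \<Rightarrow> ereal" where
  "log_ratio s = (if s = 1 then \<infinity> else ereal (ln ((1 + s) / (1 - s))))"

end

theory Submission
  imports Defs
begin

text \<open>
  Write \<open>r = dist x y\<close>, let \<open>m \<le> M\<close> be the distances of the two points to the boundary, and let
  \<open>s\<close> be their triangular ratio. Every boundary point \<open>p\<close> satisfies
  \<open>dist x p + dist y p \<ge> max r (m + M)\<close>, and the boundary point nearest to the point at distance
  \<open>m\<close> satisfies \<open>dist x p + dist y p \<le> r + 2 * m\<close>. So the geometry enters only through
  \<open>s \<le> 1\<close>, \<open>s * (M + m) \<le> r\<close>, \<open>r / (r + 2 * m) \<le> s\<close> and \<open>M \<le> m + r\<close>; both estimates are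
  then inequalities in four real numbers.

  For the lower bound, concavity of the logarithm gives \<open>s * ln 3 \<le> ln (1 + 2 * s)\<close>, and
  \<open>(1 + 2 * s) * sqrt (m * M) \<le> s * (M + m) + M \<le> r + M\<close> by the arithmetic-geometric mean
  inequality (\<open>lower_bound_real\<close>). For the upper bound with \<open>s < 1\<close>,
  \<open>(1 + s) / (1 - s) \<ge> 1 + r / m\<close>, which reduces the claim to \<open>(r + M)\<^sup>2 / (m * M) \<le> (1 + r / m) ^ 3\<close> (\<open>upper_bound_real\<close>).
  After clearing denominators this is a polynomial inequality (\<open>cubic_bound\<close>).

  The space punctured at the origin, which is connected in dimension at least two, shows that both
  constants are best possible. Two antipodal unit vectors have \<open>s = 1\<close> and Gromov distance
  \<open>2 * ln 3\<close>. Two points of one ray, at distances \<open>1\<close> and \<open>1 + t\<close> from the origin, give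
  \<open>M = m + r\<close> and \<open>(1 + s) / (1 - s) = 1 + t\<close>; the Gromov distance is
  \<open>2 * ln (1 + 2 * t) - ln (1 + t)\<close>, which is \<open>3 * t\<close> to first order, as is
  \<open>3 * ln (1 + t)\<close>.
\<close>

section \<open>Real inequalities\<close>

lemma mult_ln_3_le:
  fixes s :: real
  assumes "0 \<le> s" "s \<le> 1"
  shows "s * ln 3 \<le> ln (1 + 2 * s)"
proof -
  have "(1 - s) * ln 1 + s * ln 3 \<le> ln ((1 - s) *\<^sub>R 1 + s *\<^sub>R (3::real))"
    using assms by (intro concave_onD[OF ln_concave]) auto
  then show ?thesis
    by (simp add: algebra_simps)
qed

lemma lower_bound_real:
  fixes m M r s :: real
  assumes "0 < m" "m \<le> M" "0 \<le> s" "s \<le> 1" "s * (M + m) \<le> r"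
  shows "2 * ln 3 * s \<le> 2 * ln ((r + M) / sqrt (m * M))"
proof -
  have pos: "0 < sqrt (m * M)"
    using assms by simp
  have amgm: "2 * sqrt (m * M) \<le> m + M"
    using arith_geo_mean_sqrt[of m M] assms by simp
  have "(1 + 2 * s) * sqrt (m * M) = sqrt (m * M) + s * (2 * sqrt (m * M))"
    by (simp add: algebra_simps)
  also have "\<dots> \<le> M + s * (m + M)"
    using amgm assms by (intro add_mono mult_left_mono) auto
  also have "\<dots> \<le> r + M"
    using assms by (simp add: algebra_simps)
  finally have "1 + 2 * s \<le> (r + M) / sqrt (m * M)"
    using pos by (simp add: pos_le_divide_eq)
  then have "ln (1 + 2 * s) \<le> ln ((r + M) / sqrt (m * M))"
    using assms by (intro ln_mono) auto
  with mult_ln_3_le[OF assms(3,4)] show ?thesis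
    by (simp add: mult.commute)
qed

text \<open>In terms of the two nonnegative slacks \<open>a\<close>, \<open>b\<close> of the constraint \<open>m \<le> M \<le> m + r\<close>, the
  difference of the two sides is a polynomial in \<open>m\<close>, \<open>a\<close>, \<open>b\<close> without negative coefficients.\<close>

lemma cubic_bound:
  fixes m M r :: real
  assumes "0 < m" "m \<le> M" "M \<le> m + r"
  shows "(r + M)\<^sup>2 * m\<^sup>2 \<le> (m + r) ^ 3 * M"
proof -
  define a where "a = M - m"
  define b where "b = m + r - M"
  have ab: "0 \<le> a" "0 \<le> b" "M = m + a" "r = a + b"
    using assms by (auto simp: a_def b_def)
  have "(m + r) ^ 3 * M - (r + M)\<^sup>2 * m\<^sup>2 =
      m ^ 3 * b + m\<^sup>2 * (a * b + 2 * r\<^sup>2) + 3 * m * r\<^sup>2 * a + m * r ^ 3 + r ^ 3 * a"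
    unfolding ab(3,4) by (simp add: power2_eq_square power3_eq_cube) algebra
  also have "0 \<le> \<dots>"
    using ab(1,2) assms(1) unfolding ab(4) by simp
  finally show ?thesis
    by simp
qed

lemma upper_bound_real:
  fixes m M r s :: real
  assumes "0 < m" "m \<le> M" "M \<le> m + r" "r / (r + 2 * m) \<le> s" "s < 1"
  shows "2 * ln ((r + M) / sqrt (m * M)) \<le> 3 * ln ((1 + s) / (1 - s))"
proof -
  have r: "0 \<le> r"
    using assms by linarith
  have "r \<le> s * (r + 2 * m)"
    using assms r by (simp add: pos_divide_le_eq)
  then have ratio: "1 + r / m \<le> (1 + s) / (1 - s)"
    using assms by (simp add: field_simps)
  have "((r + M) / sqrt (m * M)) ^ 2 = (r + M)\<^sup>2 / (m * M)"
    using assms by (simp add: power_divide)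
  also have "\<dots> \<le> (1 + r / m) ^ 3"
  proof -
    have "(1 + r / m) ^ 3 = (m + r) ^ 3 / m ^ 3"
      using assms by (simp add: field_simps)
    moreover have "(r + M)\<^sup>2 / (m * M) = (r + M)\<^sup>2 * m\<^sup>2 / (m ^ 3 * M)"
      using assms by (simp add: field_simps power2_eq_square power3_eq_cube)
    moreover have "(r + M)\<^sup>2 * m\<^sup>2 / (m ^ 3 * M) \<le> (m + r) ^ 3 * M / (m ^ 3 * M)"
      using cubic_bound[OF assms(1-3)] assms by (intro divide_right_mono) auto
    ultimately show ?thesis
      using assms by simp
  qed
  also have "\<dots> \<le> ((1 + s) / (1 - s)) ^ 3"
    using ratio assms r by (intro power_mono) auto
  finally have "ln (((r + M) / sqrt (m * M)) ^ 2) \<le> ln (((1 + s) / (1 - s)) ^ 3)"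
    using assms r by (intro ln_mono) auto
  then show ?thesis
    using assms r by (simp add: ln_realpow)
qed

section \<open>Geometry of the triangular ratio\<close>

lemma triangular_ratio_commute: "triangular_ratio D x y = triangular_ratio D y x"
  by (simp add: triangular_ratio_def dist_commute add.commute)

lemma gromov_metric_commute: "gromov_metric D x y = gromov_metric D y x"
  by (simp add: gromov_metric_def dist_commute max.commute mult.commute)

lemma bdist_pos:
  assumes "open D" "frontier D \<noteq> {}" "x \<in> D"
  shows "0 < bdist D x"
  using assms infdist_pos_not_in_closed[of "frontier D" x]
  by (auto simp: bdist_def frontier_def interior_open)

lemma bdist_le_dist_add: "bdist D y \<le> bdist D x + dist x y"
  using infdist_triangle[of y "frontier D" x] by (simp add: bdist_def dist_commute)

lemma ratio_le_1: "dist x y / (dist x p + dist y p) \<le> 1"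
  using dist_triangle2[of x y p] by (intro divide_le_eq_1[THEN iffD2]) (smt (verit) zero_le_dist)

lemma ratio_le_triangular_ratio:
  assumes "p \<in> frontier D"
  shows "dist x y / (dist x p + dist y p) \<le> triangular_ratio D x y"
  unfolding triangular_ratio_def
  by (intro cSUP_upper assms bdd_aboveI2[where M = 1] ratio_le_1)

lemma triangular_ratio_nonneg:
  assumes "frontier D \<noteq> {}"
  shows "0 \<le> triangular_ratio D x y"
proof -
  obtain p where "p \<in> frontier D"
    using assms by blast
  from ratio_le_triangular_ratio[OF this, of x y] show ?thesis
    by (rule order_trans[rotated]) simp
qed

lemma triangular_ratio_le_1:
  assumes "frontier D \<noteq> {}"
  shows "triangular_ratio D x y \<le> 1"
  unfolding triangular_ratio_def using assms by (intro cSUP_least ratio_le_1)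

lemma triangular_ratio_mult_le:
  assumes "open D" "frontier D \<noteq> {}" "x \<in> D" "y \<in> D"
  shows "triangular_ratio D x y * (bdist D x + bdist D y) \<le> dist x y"
proof -
  have pos: "0 < bdist D x" "0 < bdist D y"
    using assms by (auto intro: bdist_pos)
  have "triangular_ratio D x y \<le> dist x y / (bdist D x + bdist D y)"
    unfolding triangular_ratio_def
  proof (rule cSUP_least[OF assms(2)])
    fix p assume "p \<in> frontier D"
    then have "bdist D x \<le> dist x p" "bdist D y \<le> dist y p"
      by (simp_all add: bdist_def infdist_le)
    then show "dist x y / (dist x p + dist y p) \<le> dist x y / (bdist D x + bdist D y)"
      using pos by (intro divide_left_mono) (auto intro: add_pos_pos)
  qed
  then show ?thesis
    using pos by (simp add: pos_le_divide_eq)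
qed

text \<open>The bound comes from the boundary point nearest to \<open>x\<close>, which exists because closed bounded
  sets are compact.\<close>

lemma triangular_ratio_ge:
  fixes D :: "'a::heine_borel set"
  assumes "open D" "frontier D \<noteq> {}" "x \<in> D"
  shows "dist x y / (dist x y + 2 * bdist D x) \<le> triangular_ratio D x y"
proof -
  obtain p where p: "p \<in> frontier D" "bdist D x = dist x p"
    using infdist_attains_inf[OF frontier_closed assms(2), of x] by (auto simp: bdist_def)
  have pos: "0 < dist x p"
    using bdist_pos[OF assms] p by simp
  have "dist y p \<le> dist x y + dist x p"
    using dist_triangle[of y p x] by (simp add: dist_commute)
  then have "dist x y / (dist x y + 2 * bdist D x) \<le> dist x y / (dist x p + dist y p)"
    using pos p by (intro divide_left_mono mult_pos_pos) (auto intro: add_pos_nonneg add_nonneg_pos)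
  also have "\<dots> \<le> triangular_ratio D x y"
    by (rule ratio_le_triangular_ratio[OF p(1)])
  finally show ?thesis .
qed

section \<open>The two-sided estimate\<close>

lemma triangular_ratio_le_gromov_metric:
  assumes "open D" "frontier D \<noteq> {}" "x \<in> D" "y \<in> D"
  shows "2 * ln 3 * triangular_ratio D x y \<le> gromov_metric D x y"
proof -
  have *: "2 * ln 3 * triangular_ratio D x y \<le> gromov_metric D x y"
    if "bdist D x \<le> bdist D y" "x \<in> D" "y \<in> D" for x y
    using lower_bound_real[OF bdist_pos[OF assms(1,2) that(2)] that(1)
        triangular_ratio_nonneg[OF assms(2)] triangular_ratio_le_1[OF assms(2)], of x y "dist x y"]
      triangular_ratio_mult_le[OF assms(1,2) that(2,3)] that(1)
    by (simp add: gromov_metric_def add.commute)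
  show ?thesis
    using *[of x y] *[of y x] assms(3,4) triangular_ratio_commute[of D x y]
      gromov_metric_commute[of D x y] by fastforce
qed

lemma gromov_metric_le_log_ratio:
  fixes D :: "'a::heine_borel set"
  assumes "open D" "frontier D \<noteq> {}" "x \<in> D" "y \<in> D"
  shows "ereal (gromov_metric D x y) \<le> 3 * log_ratio (triangular_ratio D x y)"
proof (cases "triangular_ratio D x y = 1")
  case True
  then show ?thesis
    by (simp add: log_ratio_def)
next
  case False
  have *: "gromov_metric D x y \<le> 3 * ln ((1 + triangular_ratio D x y) / (1 - triangular_ratio D x y))"
    if "bdist D x \<le> bdist D y" "x \<in> D" "triangular_ratio D x y < 1" for x y
    using upper_bound_real[OF bdist_pos[OF assms(1,2) that(2)] that(1) bdist_le_dist_add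
        triangular_ratio_ge[OF assms(1,2) that(2)] that(3)] that(1)
    by (simp add: gromov_metric_def)
  have "triangular_ratio D x y < 1"
    using False triangular_ratio_le_1[OF assms(2), of x y] by simp
  then have "gromov_metric D x y \<le> 3 * ln ((1 + triangular_ratio D x y) / (1 - triangular_ratio D x y))"
    using *[of x y] *[of y x] assms(3,4) triangular_ratio_commute[of D x y]
      gromov_metric_commute[of D x y] by fastforce
  then have "ereal (gromov_metric D x y)
      \<le> ereal (3 * ln ((1 + triangular_ratio D x y) / (1 - triangular_ratio D x y)))"
    by simp
  with False show ?thesis
    by (simp add: log_ratio_def flip: times_ereal.simps(1))
qed

section \<open>The punctured space\<close>

lemma frontier_zero: "frontier {0 :: 'a::euclidean_space} = {0}"
  by (simp add: frontier_def)

lemma domain_punctured: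
  assumes "2 \<le> DIM('a::euclidean_space)"
  shows "domain (- {0 :: 'a})"
proof -
  obtain b :: 'a where "b \<in> Basis"
    using nonempty_Basis by blast
  then have "b \<in> - {0}"
    by auto
  then show ?thesis
    using connected_punctured_universe[OF assms, of 0] unfolding domain_def by blast
qed

lemma gromov_metric_punctured:
  "gromov_metric (- {0}) x y =
     2 * ln ((dist x y + max (norm x) (norm y)) / sqrt (norm x * norm y))"
  for x y :: "'a::euclidean_space"
  by (simp add: gromov_metric_def bdist_def frontier_zero infdist_singleton)

lemma triangular_ratio_punctured:
  "triangular_ratio (- {0}) x y = dist x y / (norm x + norm y)"
  for x y :: "'a::euclidean_space"
  by (simp add: triangular_ratio_def frontier_zero)

lemma lower_constant_sharp:
  assumes "2 * ln 3 < c"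
  shows "\<exists>x\<in>- {0}. \<exists>y\<in>- {0 :: 'a::euclidean_space}.
           gromov_metric (- {0}) x y < c * triangular_ratio (- {0}) x y"
proof -
  obtain e :: 'a where e: "norm e = 1"
    using nonempty_Basis norm_Basis by blast
  have "dist (- e) e = norm (2 *\<^sub>R e)"
    by (metis dist_commute dist_norm diff_minus_eq_add scaleR_2)
  then have "dist (- e) e = 2"
    using e by simp
  with e assms have "gromov_metric (- {0}) (- e) e < c * triangular_ratio (- {0}) (- e) e"
    by (simp add: gromov_metric_punctured triangular_ratio_punctured)
  moreover have "e \<noteq> 0"
    using e by auto
  ultimately show ?thesis
    by (metis Compl_iff neg_equal_0_iff_equal singletonD)
qed

text \<open>For small \<open>t\<close> the two sides behave like \<open>(c + 1) * t\<close> and \<open>4 * t\<close>. This is the comparison of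
  \<open>c * ln (1 + t)\<close> with the Gromov distance \<open>2 * ln (1 + 2 * t) - ln (1 + t)\<close> of two points at
  distances \<open>1\<close> and \<open>1 + t\<close> on one ray.\<close>

lemma log_gap_on_ray:
  fixes c :: real
  assumes "c < 3"
  shows "\<exists>t>0. (c + 1) * ln (1 + t) < 2 * ln (1 + 2 * t)"
proof (cases "c + 1 \<le> 0")
  case True
  then have "(c + 1) * ln (1 + 1) \<le> 0"
    by (intro mult_nonpos_nonneg) auto
  moreover have "0 < 2 * ln (1 + 2 * (1::real))"
    by simp
  ultimately show ?thesis
    by (intro exI[of _ 1]) linarith
next
  case False
  \<comment> \<open>With \<open>1 - 1 / z \<le> ln z \<le> z - 1\<close> it suffices that \<open>(c + 1) * (1 + 2 * t) < 4\<close>.\<close>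
  define t where "t = (3 - c) / 8"
  have t: "0 < t"
    using assms by (simp add: t_def)
  have "(c + 1) * (1 + 2 * t) = 4 - 16 * t\<^sup>2"
    by (simp add: t_def field_simps power2_eq_square)
  then have "(c + 1) * (1 + 2 * t) < 4"
    using t by simp
  then have "(c + 1) * t * (1 + 2 * t) < 4 * t"
    using t by (simp add: mult.commute mult.left_commute)
  then have *: "(c + 1) * t < 2 * (1 - 1 / (1 + 2 * t))"
    using t by (simp add: field_simps)
  have "(c + 1) * ln (1 + t) \<le> (c + 1) * t"
    using False t ln_add_one_self_le_self[of t] by (intro mult_left_mono) auto
  also note *
  also have "2 * (1 - 1 / (1 + 2 * t)) \<le> 2 * ln (1 + 2 * t)"
    using t ln_le_minus_one[of "1 / (1 + 2 * t)"] by (simp add: ln_div)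
  finally show ?thesis
    using t by blast
qed

lemma upper_constant_sharp:
  assumes "c < 3"
  shows "\<exists>x\<in>- {0}. \<exists>y\<in>- {0 :: 'a::euclidean_space}.
           ereal c * log_ratio (triangular_ratio (- {0}) x y) < ereal (gromov_metric (- {0}) x y)"
proof -
  obtain e :: 'a where e: "norm e = 1"
    using nonempty_Basis norm_Basis by blast
  obtain t where t: "0 < t" "(c + 1) * ln (1 + t) < 2 * ln (1 + 2 * t)"
    using log_gap_on_ray[OF assms] by blast
  define y where "y = (1 + t) *\<^sub>R e"
  have "e - y = - t *\<^sub>R e"
    by (simp add: y_def scaleR_left_distrib)
  then have y: "norm y = 1 + t" "dist e y = t"
    using t e by (simp_all add: dist_norm) (simp add: y_def)
  have s: "triangular_ratio (- {0}) e y = t / (2 + t)"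
    by (simp add: triangular_ratio_punctured e y)
  have "(1 + t / (2 + t)) / (1 - t / (2 + t)) = 1 + t"
    using t by (simp add: field_simps)
  then have "log_ratio (triangular_ratio (- {0}) e y) = ereal (ln (1 + t))"
    using t by (simp add: log_ratio_def s)
  moreover have "gromov_metric (- {0}) e y = 2 * ln (1 + 2 * t) - ln (1 + t)"
    using t by (simp add: gromov_metric_punctured e y ln_div ln_sqrt algebra_simps)
  moreover have "e \<noteq> 0" "y \<noteq> 0"
    using e y t by auto
  ultimately show ?thesis
    using t by (intro bexI[of _ e] bexI[of _ y]) (auto simp: algebra_simps)
qed

theorem theorem5p10:
  assumes "CARD('n::finite) \<ge> 2"
  shows "(\<forall>D :: (real ^ 'n) set. domain D \<longrightarrow> D \<noteq> UNIV \<longrightarrow> (\<forall>x\<in>D. \<forall>y\<in>D.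
             2 * ln 3 * triangular_ratio D x y \<le> gromov_metric D x y \<and>
             ereal (gromov_metric D x y) \<le> 3 * log_ratio (triangular_ratio D x y)))
       \<and> (\<forall>c > 2 * ln 3. \<not> (\<forall>D :: (real ^ 'n) set. domain D \<longrightarrow> D \<noteq> UNIV \<longrightarrow> (\<forall>x\<in>D. \<forall>y\<in>D.
             c * triangular_ratio D x y \<le> gromov_metric D x y)))
       \<and> (\<forall>c < (3::real). \<not> (\<forall>D :: (real ^ 'n) set. domain D \<longrightarrow> D \<noteq> UNIV \<longrightarrow> (\<forall>x\<in>D. \<forall>y\<in>D.
             ereal (gromov_metric D x y) \<le> ereal c * log_ratio (triangular_ratio D x y))))"
proof (intro conjI)
  show "\<forall>D :: (real ^ 'n) set. domain D \<longrightarrow> D \<noteq> UNIV \<longrightarrow> (\<forall>x\<in>D. \<forall>y\<in>D.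
          2 * ln 3 * triangular_ratio D x y \<le> gromov_metric D x y \<and>
          ereal (gromov_metric D x y) \<le> 3 * log_ratio (triangular_ratio D x y))"
  proof (intro allI impI ballI)
    fix D :: "(real ^ 'n) set" and x y
    assume D: "domain D" "D \<noteq> UNIV" and xy: "x \<in> D" "y \<in> D"
    have "open D" "frontier D \<noteq> {}"
      using D by (auto simp: domain_def frontier_eq_empty)
    then show "2 * ln 3 * triangular_ratio D x y \<le> gromov_metric D x y \<and>
        ereal (gromov_metric D x y) \<le> 3 * log_ratio (triangular_ratio D x y)"
      using xy by (intro conjI triangular_ratio_le_gromov_metric gromov_metric_le_log_ratio)
  qed
next
  have D: "domain (- {0 :: real ^ 'n})" "- {0 :: real ^ 'n} \<noteq> UNIV"
    using assms by (auto intro: domain_punctured)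
  show "\<forall>c > 2 * ln 3. \<not> (\<forall>D :: (real ^ 'n) set. domain D \<longrightarrow> D \<noteq> UNIV \<longrightarrow> (\<forall>x\<in>D. \<forall>y\<in>D.
          c * triangular_ratio D x y \<le> gromov_metric D x y))"
    using D lower_constant_sharp[where 'a = "real ^ 'n"] by (meson linorder_not_le)
  show "\<forall>c < (3::real). \<not> (\<forall>D :: (real ^ 'n) set. domain D \<longrightarrow> D \<noteq> UNIV \<longrightarrow> (\<forall>x\<in>D. \<forall>y\<in>D.
          ereal (gromov_metric D x y) \<le> ereal c * log_ratio (triangular_ratio D x y)))"
    using D upper_constant_sharp[where 'a = "real ^ 'n"] by (meson linorder_not_le)
qed

end
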